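(* Let $\mathbf{E}\subset\mathbb{C}^{\mathbb{Z}^+}$ be a Banach space of sequences satisfying (i)–(iii) of the context. If $\mathbf{S}$ and $\mathbf{S}_{-1}$ are bounded operators on $\mathbf{E}$, then $$\sigma(\mathbf{S})=\{z\in\mathbb{C}:|z|\le\rho(\mathbf{S})\}$$ and $$\sigma(\mathbf{S}_{-1})=\{z\in\mathbb{C}:|z|\le\rho(\mathbf{S}_{-1})\}.$$
   Context: $\mathbb{Z}^+$ is the set of non-negative integers and $F(\mathbb{Z}^+)$ the set of complex sequences on $\mathbb{Z}^+$ with finitely many non-zero terms. $\mathbf{E}\subset\mathbb{C}^{\mathbb{Z}^+}$ is a Banach space with: (i) $F(\mathbb{Z}^+)$ is a dense subset of $\mathbf{E}$; (ii) for every $n\in\mathbb{Z}^+$ the map $x\mapsto x(n)$ is continuous from $\mathbf{E}$ to $\mathbb{C}$; (iii) for every $z\in\mathbb{T}=\{z\in\mathbb{C}:|z|=1\}$ and $x\in\mathbf{E}$, $\gamma_z(x)=(z^nx(n))_{n\in\mathbb{Z}^+}\in\mathbf{E}$, and $\sup_{z\in\mathbb{T}}\|\gamma_z\|<+\infty$. On $\mathbb{C}^{\mathbb{Z}^+}$ define $(\mathbf{S}u)(0)=0$, $(\mathbf{S}u)(n)=u(n-1)$ for $n\ge1$, and $(\mathbf{S}_{-1}u)(n)=u(n+1)$ for $n\ge0$. $\mathbf{S}$ (resp. $\mathbf{S}_{-1}$) is called bounded if it maps $\mathbf{E}$ into $\mathbf{E}$; its restriction to $\mathbf{E}$ is then a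 bounded operator, and $\sigma(\cdot)$, $\rho(\cdot)$ denote the spectrum and spectral radius of this restriction. *)

theory Defs
  imports "HOL-Analysis.Analysis" "HOL-Library.Function_Algebras"
begin

type_synonym cseq = "nat \<Rightarrow> complex"

definition seq_scale :: "complex \<Rightarrow> cseq \<Rightarrow> cseq" where
  "seq_scale c x = (\<lambda>n. c * x n)"

text \<open>
  A space of sequences is given by a carrier set \<open>E\<close> and a function \<open>nrm\<close>, of which only the
  values on \<open>E\<close> matter. The distance is set to 0 off \<open>E\<close> because the library locale
  \<^locale>\<open>Metric_space\<close> requires non-negativity and symmetry on the whole type.
\<close>

definition seq_dist :: "cseq set \<Rightarrow> (cseq \<Rightarrow> real) \<Rightarrow> cseq \<Rightarrow> cseq \<Rightarrow> real" where
  "seq_dist E nrm x y = (if x \<in> E \<and> y \<in> E then nrm (x - y) else 0)"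

locale normed_seq_space =
  fixes E :: "cseq set" and nrm :: "cseq \<Rightarrow> real"
  assumes zero_mem: "0 \<in> E"
    and add_mem: "\<lbrakk>x \<in> E; y \<in> E\<rbrakk> \<Longrightarrow> x + y \<in> E"
    and scale_mem: "x \<in> E \<Longrightarrow> seq_scale c x \<in> E"
    and nrm_eq_0: "x \<in> E \<Longrightarrow> nrm x = 0 \<longleftrightarrow> x = 0"
    and nrm_triangle: "\<lbrakk>x \<in> E; y \<in> E\<rbrakk> \<Longrightarrow> nrm (x + y) \<le> nrm x + nrm y"
    and nrm_scale: "x \<in> E \<Longrightarrow> nrm (seq_scale c x) = cmod c * nrm x"
begin

lemma uminus_eq_scale: "- x = seq_scale (- 1) (x :: cseq)"
  by (simp add: seq_scale_def fun_eq_iff)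

lemma uminus_mem: "x \<in> E \<Longrightarrow> - x \<in> E"
  by (simp add: uminus_eq_scale scale_mem)

lemma nrm_uminus: "x \<in> E \<Longrightarrow> nrm (- x) = nrm x"
  by (simp add: uminus_eq_scale nrm_scale)

lemma diff_mem: "\<lbrakk>x \<in> E; y \<in> E\<rbrakk> \<Longrightarrow> x - y \<in> E"
  using add_mem[of x "- y"] uminus_mem[of y] by simp

lemma nrm_nonneg: "x \<in> E \<Longrightarrow> 0 \<le> nrm x"
  using nrm_triangle[of x "- x"] nrm_uminus[of x] uminus_mem[of x] nrm_eq_0[OF zero_mem]
  by simp

sublocale Metric_space E "seq_dist E nrm"
proof
  fix x y z
  show "0 \<le> seq_dist E nrm x y"
    by (simp add: seq_dist_def diff_mem nrm_nonneg)
  show "seq_dist E nrm x y = seq_dist E nrm y x"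
    using nrm_uminus[of "x - y"] by (auto simp: seq_dist_def diff_mem)
  show "seq_dist E nrm x y = 0 \<longleftrightarrow> x = y" if "x \<in> E" "y \<in> E"
    using that by (simp add: seq_dist_def diff_mem nrm_eq_0)
  show "seq_dist E nrm x z \<le> seq_dist E nrm x y + seq_dist E nrm y z"
    if "x \<in> E" "y \<in> E" "z \<in> E"
    using that nrm_triangle[of "x - y" "y - z"] by (simp add: seq_dist_def diff_mem)
qed

end

locale banach_seq_space = normed_seq_space +
  assumes complete: mcomplete

definition finite_seqs :: "cseq set" where
  "finite_seqs = {x. finite {n. x n \<noteq> 0}}"

definition rotation :: "complex \<Rightarrow> cseq \<Rightarrow> cseq" where
  "rotation z x = (\<lambda>n. z ^ n * x n)"

locale rotation_banach_seq_space = banach_seq_space +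
  assumes finite_seqs_subset: "finite_seqs \<subseteq> E"
    and finite_seqs_dense: "mtopology closure_of finite_seqs = E"
    and coordinate_continuous: "continuous_map mtopology euclidean (\<lambda>x. x n)"
    and rotation_mem: "\<lbrakk>cmod z = 1; x \<in> E\<rbrakk> \<Longrightarrow> rotation z x \<in> E"
    and rotation_bounded:
      "\<exists>C. \<forall>z. cmod z = 1 \<longrightarrow> (\<forall>x\<in>E. nrm (rotation z x) \<le> C * nrm x)"

definition right_shift :: "cseq \<Rightarrow> cseq" where
  "right_shift u = (\<lambda>n. if n = 0 then 0 else u (n - 1))"

definition left_shift :: "cseq \<Rightarrow> cseq" where
  "left_shift u = (\<lambda>n. u (n + 1))"

definition bounded_op_on ::
    "cseq set \<Rightarrow> (cseq \<Rightarrow> real) \<Rightarrow> (cseq \<Rightarrow> cseq) \<Rightarrow> bool" where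
  "bounded_op_on E nrm T \<longleftrightarrow>
     T ` E \<subseteq> E \<and>
     (\<forall>x\<in>E. \<forall>y\<in>E. T (x + y) = T x + T y) \<and>
     (\<forall>c. \<forall>x\<in>E. T (seq_scale c x) = seq_scale c (T x)) \<and>
     (\<exists>C. \<forall>x\<in>E. nrm (T x) \<le> C * nrm x)"

text \<open>
  Spectrum of the restriction of \<open>T\<close> to \<open>E\<close>: the \<open>l\<close> for which \<open>T - l I\<close> has no two-sided
  inverse among the bounded operators on \<open>E\<close>. Values of \<open>T\<close> and \<open>R\<close> off \<open>E\<close> are irrelevant.
\<close>

definition spectrum_on ::
    "cseq set \<Rightarrow> (cseq \<Rightarrow> real) \<Rightarrow> (cseq \<Rightarrow> cseq) \<Rightarrow> complex set" where
  "spectrum_on E nrm T =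
     {l. \<not> (\<exists>R. bounded_op_on E nrm R \<and>
             (\<forall>x\<in>E. R (T x - seq_scale l x) = x) \<and>
             (\<forall>x\<in>E. T (R x) - seq_scale l (R x) = x))}"

definition spectral_radius_on ::
    "cseq set \<Rightarrow> (cseq \<Rightarrow> real) \<Rightarrow> (cseq \<Rightarrow> cseq) \<Rightarrow> real" where
  "spectral_radius_on E nrm T = (SUP l\<in>spectrum_on E nrm T. cmod l)"

end

theory Submission imports Defs begin

text \<open>
  Let T be one of the two shifts. Rotations conjugate T to its unimodular multiples, so the
  spectrum is invariant under rotation, and it contains 0. What has to be excluded is a gap: a
  point l, not 0, of the resolvent set, with spectrum further out.

  Let R be the inverse of T - l. As T moves every unit sequence by one step, R has the
  operator - T ^ n / l ^ (n + 1) as its n-th diagonal (below the main one for the right shift,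
  above it for the left shift). For the right shift this is the expansion of the resolvent
  that one knows from large l; it holds for every such l, because the equation T u - l u = v
  determines the coordinates of u one after the other. For the left shift the expansion is a finite
  sum on every finite sequence. A diagonal of R is, on finite
  sequences, a limit of averages of conjugates of R under rotations, so the
  uniform bound on the rotations makes passing to a diagonal a bounded operation
  (\<open>nrm_diagonal_le\<close>). Hence all T ^ n / l ^ n are bounded by one constant
  (\<open>power_bound_of_resolvent\<close>), and the Neumann series puts every m with modulus larger than that of l into
  the resolvent set. As the resolvent set is open and invariant under rotation, the whole spectrum
  then lies in a disc of radius strictly less than the modulus of l (\<open>spectrum_eq_disc\<close>).

  The averages are taken over N-th roots of unity, with N tending to infinity, and not as
  integrals over the circle; so finite sums are the only integration that is needed.

  The shifts are bounded, by Baire category, because of their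
  mapping E into E with continuous coordinates (\<open>coordinatewise_bounded_imp_bounded\<close>).
\<close>

section \<open>Linear operators on a normed sequence space\<close>

definition linear_op_on :: "cseq set \<Rightarrow> (cseq \<Rightarrow> cseq) \<Rightarrow> bool" where
  "linear_op_on E T \<longleftrightarrow>
     T ` E \<subseteq> E \<and>
     (\<forall>x\<in>E. \<forall>y\<in>E. T (x + y) = T x + T y) \<and>
     (\<forall>c. \<forall>x\<in>E. T (seq_scale c x) = seq_scale c (T x))"

lemma bounded_op_on_iff_linear:
  "bounded_op_on E nrm T \<longleftrightarrow> linear_op_on E T \<and> (\<exists>C. \<forall>x\<in>E. nrm (T x) \<le> C * nrm x)"
  by (auto simp: bounded_op_on_def linear_op_on_def)

lemma bounded_op_on_linear: "bounded_op_on E nrm T \<Longrightarrow> linear_op_on E T"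
  by (simp add: bounded_op_on_iff_linear)

lemma seq_scale_apply [simp]: "seq_scale c x n = c * x n"
  by (simp add: seq_scale_def)

lemma seq_scale_simps [simp]:
  "seq_scale 1 x = x" "seq_scale 0 x = 0" "seq_scale c 0 = 0"
  "seq_scale a (seq_scale b x) = seq_scale (a * b) x"
  by (simp_all add: fun_eq_iff)

lemma seq_sum_apply: "(\<Sum>i\<in>A. f i) n = (\<Sum>i\<in>A. f i (n::nat) :: complex)"
  by (induction A rule: infinite_finite_induct) auto

context normed_seq_space
begin

lemma sum_mem: "(\<And>i. i \<in> A \<Longrightarrow> f i \<in> E) \<Longrightarrow> (\<Sum>i\<in>A. f i) \<in> E"
  by (induction A rule: infinite_finite_induct) (auto simp: zero_mem intro: add_mem)

lemma nrm_zero [simp]: "nrm 0 = 0"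
  using nrm_eq_0 zero_mem by blast

lemma nrm_sum: "(\<And>i. i \<in> A \<Longrightarrow> f i \<in> E) \<Longrightarrow> nrm (\<Sum>i\<in>A. f i) \<le> (\<Sum>i\<in>A. nrm (f i))"
proof (induction A rule: infinite_finite_induct)
  case (insert a A)
  then have "nrm (f a + (\<Sum>i\<in>A. f i)) \<le> nrm (f a) + nrm (\<Sum>i\<in>A. f i)"
    by (intro nrm_triangle sum_mem) auto
  moreover have "nrm (\<Sum>i\<in>A. f i) \<le> (\<Sum>i\<in>A. nrm (f i))" using insert by blast
  ultimately show ?case by (simp only: sum.insert[OF insert.hyps])
qed auto

lemma nrm_diff_commute: "\<lbrakk>x \<in> E; y \<in> E\<rbrakk> \<Longrightarrow> nrm (x - y) = nrm (y - x)"
  using nrm_uminus[of "x - y"] diff_mem[of x y] by simp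

lemma nrm_diff_triangle: "\<lbrakk>x \<in> E; y \<in> E\<rbrakk> \<Longrightarrow> nrm (x - y) \<le> nrm x + nrm y"
  using nrm_triangle[of x "- y"] nrm_uminus[of y] uminus_mem[of y] by simp

lemma nrm_le_add_diff: "\<lbrakk>x \<in> E; y \<in> E\<rbrakk> \<Longrightarrow> nrm x \<le> nrm y + nrm (x - y)"
  using nrm_triangle[of y "x - y"] diff_mem[of x y] by simp

lemma linear_op_mem: "linear_op_on E T \<Longrightarrow> x \<in> E \<Longrightarrow> T x \<in> E"
  by (auto simp: linear_op_on_def)

lemma linear_op_add: "\<lbrakk>linear_op_on E T; x \<in> E; y \<in> E\<rbrakk> \<Longrightarrow> T (x + y) = T x + T y"
  by (auto simp: linear_op_on_def)

lemma linear_op_scale: "\<lbrakk>linear_op_on E T; x \<in> E\<rbrakk> \<Longrightarrow> T (seq_scale c x) = seq_scale c (T x)"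
  by (auto simp: linear_op_on_def)

lemma linear_op_zero: "linear_op_on E T \<Longrightarrow> T 0 = 0"
  using linear_op_scale[of T 0 0] zero_mem by simp

lemma linear_op_diff:
  assumes "linear_op_on E T" "x \<in> E" "y \<in> E" shows "T (x - y) = T x - T y"
  using linear_op_add[OF assms(1), of "x - y" y] assms diff_mem by (simp add: algebra_simps)

lemma linear_op_sum:
  "linear_op_on E T \<Longrightarrow> (\<And>i. i \<in> A \<Longrightarrow> f i \<in> E) \<Longrightarrow> T (\<Sum>i\<in>A. f i) = (\<Sum>i\<in>A. T (f i))"
  by (induction A rule: infinite_finite_induct)
     (auto simp: linear_op_zero linear_op_add sum_mem)

lemma bounded_op_bound:
  assumes "bounded_op_on E nrm T"
  obtains K where "K > 0" "\<And>x. x \<in> E \<Longrightarrow> nrm (T x) \<le> K * nrm x"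
proof -
  obtain C where C: "\<And>x. x \<in> E \<Longrightarrow> nrm (T x) \<le> C * nrm x"
    using assms unfolding bounded_op_on_def by blast
  have "nrm (T x) \<le> max C 1 * nrm x" if "x \<in> E" for x
    using C[OF that] nrm_nonneg[OF that] mult_right_mono[of C "max C 1" "nrm x"] by linarith
  then show thesis using that[of "max C 1"] by auto
qed

lemma bounded_op_compose:
  assumes S: "bounded_op_on E nrm S" and T: "bounded_op_on E nrm T"
  shows "bounded_op_on E nrm (\<lambda>x. S (T x))"
proof -
  obtain K where K: "K > 0" "\<And>x. x \<in> E \<Longrightarrow> nrm (S x) \<le> K * nrm x"
    by (rule bounded_op_bound[OF S]) blast
  obtain L where L: "L > 0" "\<And>x. x \<in> E \<Longrightarrow> nrm (T x) \<le> L * nrm x"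
    by (rule bounded_op_bound[OF T]) blast
  note lin = bounded_op_on_linear[OF S] bounded_op_on_linear[OF T]
  have "nrm (S (T x)) \<le> K * L * nrm x" if "x \<in> E" for x
  proof -
    have "nrm (S (T x)) \<le> K * nrm (T x)" using K linear_op_mem[OF lin(2) that] by blast
    also have "\<dots> \<le> K * (L * nrm x)" using K L that by (intro mult_left_mono) auto
    finally show ?thesis by (simp add: mult.assoc)
  qed
  with lin show ?thesis
    unfolding bounded_op_on_iff_linear
    by (auto simp: linear_op_on_def image_subset_iff)
qed

lemma bounded_op_scale: "bounded_op_on E nrm (seq_scale c)"
  unfolding bounded_op_on_iff_linear linear_op_on_def
  by (auto simp: scale_mem nrm_scale fun_eq_iff algebra_simps)

lemma bounded_op_id: "bounded_op_on E nrm (\<lambda>x. x)"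
  unfolding bounded_op_on_iff_linear linear_op_on_def by (auto intro: exI[of _ 1])

lemma bounded_op_funpow: "bounded_op_on E nrm T \<Longrightarrow> bounded_op_on E nrm (T ^^ n)"
  by (induction n) (auto simp: bounded_op_id id_def comp_def intro: bounded_op_compose)

lemma bounded_inverse:
  assumes T: "linear_op_on E T"
    and inj: "\<And>x. \<lbrakk>x \<in> E; T x = 0\<rbrakk> \<Longrightarrow> x = 0"
    and surj: "\<And>y. y \<in> E \<Longrightarrow> \<exists>x\<in>E. T x = y \<and> nrm x \<le> K * nrm y"
  obtains G where "bounded_op_on E nrm G"
    "\<And>x. x \<in> E \<Longrightarrow> G (T x) = x" "\<And>x. x \<in> E \<Longrightarrow> T (G x) = x"
proof -
  obtain G where G: "\<And>y. y \<in> E \<Longrightarrow> G y \<in> E \<and> T (G y) = y \<and> nrm (G y) \<le> K * nrm y"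
    using surj by metis
  have unique: "x = y" if "x \<in> E" "y \<in> E" "T x = T y" for x y
    using inj[of "x - y"] linear_op_diff[OF T, of x y] that diff_mem by auto
  have "G (x + y) = G x + G y" if "x \<in> E" "y \<in> E" for x y
    by (rule unique) (use that in \<open>simp_all add: G add_mem linear_op_add[OF T]\<close>)
  moreover have "G (seq_scale c x) = seq_scale c (G x)" if "x \<in> E" for c x
    by (rule unique) (use that in \<open>simp_all add: G scale_mem linear_op_scale[OF T]\<close>)
  ultimately have "bounded_op_on E nrm G"
    unfolding bounded_op_on_def using G by (intro conjI exI[of _ K]) auto
  moreover have "G (T x) = x" if "x \<in> E" for x
    by (rule unique) (use that linear_op_mem[OF T] in \<open>simp_all add: G\<close>)
  ultimately show thesis using that G by blast
qed

lemma not_in_spectrum_iff: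
  "l \<notin> spectrum_on E nrm T \<longleftrightarrow> (\<exists>R. bounded_op_on E nrm R \<and>
     (\<forall>x\<in>E. R (T x - seq_scale l x) = x) \<and> (\<forall>x\<in>E. T (R x) - seq_scale l (R x) = x))"
  by (simp add: spectrum_on_def)

end

section \<open>Geometric series and the Neumann series\<close>

context banach_seq_space
begin

text \<open>Completeness enters the whole development through this lemma: both the Neumann series and the
  closed graph theorem sum a series with geometrically decreasing terms. The bound on the sum keeps
  the constants of the terms, so that it yields operator bounds.\<close>

lemma geometric_series_converges:
  assumes f: "\<And>k. f k \<in> E" and le: "\<And>k. nrm (f k) \<le> c * q ^ k" and q: "0 \<le> q" "q < 1"
  obtains s where "s \<in> E" "(\<lambda>n. nrm ((\<Sum>k<n. f k) - s)) \<longlonglongrightarrow> 0" "nrm s \<le> c / (1 - q)"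
proof -
  define p where "p n = (\<Sum>k<n. f k)" for n
  have p: "p n \<in> E" for n unfolding p_def by (intro sum_mem f)
  have c: "0 \<le> c" using le[of 0] nrm_nonneg[OF f[of 0]] by simp
  have summ: "summable (\<lambda>k. c * q ^ k)" using q by (intro summable_mult summable_geometric) simp
  have "MCauchy p"
    unfolding MCauchy_def
  proof (intro conjI allI impI)
    show "range p \<subseteq> E" using p by auto
    fix e :: real assume "e > 0"
    then obtain N where N: "\<And>m n. m \<ge> N \<Longrightarrow> norm (\<Sum>k=m..<n. c * q ^ k) < e"
      using summ unfolding summable_Cauchy by blast
    have *: "seq_dist E nrm (p m) (p n) < e" if "N \<le> m" "m \<le> n" for m n
    proof -
      have eq: "p n - p m = (\<Sum>k=m..<n. f k)"
        using sum_diff_nat_ivl[of 0 m n f] that by (simp add: p_def atLeast0LessThan)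
      have "nrm (p n - p m) \<le> (\<Sum>k=m..<n. nrm (f k))"
        unfolding eq by (intro nrm_sum f)
      also have "\<dots> \<le> (\<Sum>k=m..<n. c * q ^ k)" by (intro sum_mono le)
      also have "\<dots> < e" using N[OF that(1), of n] by simp
      finally show ?thesis using p nrm_diff_commute by (simp add: seq_dist_def)
    qed
    show "\<exists>N. \<forall>n n'. N \<le> n \<longrightarrow> N \<le> n' \<longrightarrow> seq_dist E nrm (p n) (p n') < e"
      by (intro exI[of _ N]) (metis * commute nat_le_linear)
  qed
  then obtain s where "limitin mtopology p s sequentially"
    using complete unfolding mcomplete_def by blast
  then have s: "s \<in> E" and lim: "(\<lambda>n. nrm (p n - s)) \<longlonglongrightarrow> 0"
    using p unfolding limitin_metric_dist_null by (auto simp: seq_dist_def)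
  have "nrm s \<le> c / (1 - q) + nrm (p n - s)" for n
  proof -
    have "nrm (p n) \<le> (\<Sum>k<n. nrm (f k))" unfolding p_def by (intro nrm_sum f)
    also have "\<dots> \<le> (\<Sum>k<n. c * q ^ k)" by (intro sum_mono le)
    also have "\<dots> \<le> (\<Sum>k. c * q ^ k)" using summ c q by (intro sum_le_suminf) auto
    also have "\<dots> = c / (1 - q)" using q by (simp add: suminf_mult suminf_geometric summable_geometric)
    finally show ?thesis
      using nrm_le_add_diff[OF s p[of n]] nrm_diff_commute[OF s p[of n]] by linarith
  qed
  then have "nrm s \<le> c / (1 - q) + 0"
    by (intro LIMSEQ_le_const[OF tendsto_add[OF tendsto_const lim]]) blast
  then show thesis using that[OF s] lim by (simp add: p_def)
qed

lemma geometric_tendsto_zero: "0 \<le> q \<Longrightarrow> q < 1 \<Longrightarrow> (\<lambda>n. c * q ^ n) \<longlonglongrightarrow> (0::real)"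
  by (intro tendsto_mult_right_zero LIMSEQ_realpow_zero)

lemma nrm_zero_if_tendsto:
  assumes "x \<in> E" "\<And>n::nat. nrm x \<le> h n" "h \<longlonglongrightarrow> 0" shows "x = 0"
  using LIMSEQ_le_const[OF assms(3), of "nrm x"] assms nrm_nonneg[OF assms(1)] nrm_eq_0[OF assms(1)]
  by force

text \<open>The bound is asked of the powers of B and not of B itself: an operator of spectral radius less
  than 1 may have norm larger than 1, and the powers of the shifts will only be controlled up to a
  constant factor. Injectivity of I - B holds because a fixed vector of B is a fixed vector of every
  power; surjectivity comes from the series, whose partial sums telescope under I - B.\<close>

lemma neumann_inverse:
  assumes B: "bounded_op_on E nrm B"
    and pow: "\<And>n x. x \<in> E \<Longrightarrow> nrm ((B ^^ n) x) \<le> M * q ^ n * nrm x" and q: "0 \<le> q" "q < 1"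
  obtains G where "bounded_op_on E nrm G"
    "\<And>x. x \<in> E \<Longrightarrow> G (x - B x) = x" "\<And>x. x \<in> E \<Longrightarrow> G x - B (G x) = x"
proof -
  note lin = bounded_op_on_linear[OF B]
  obtain K where K: "K > 0" "\<And>x. x \<in> E \<Longrightarrow> nrm (B x) \<le> K * nrm x"
    by (rule bounded_op_bound[OF B]) blast
  have mem: "(B ^^ n) x \<in> E" if "x \<in> E" for n x
    using linear_op_mem[OF bounded_op_on_linear[OF bounded_op_funpow[OF B]]] that by blast
  have linear: "linear_op_on E (\<lambda>x. x - B x)"
    using lin diff_mem by (auto simp: linear_op_on_def fun_eq_iff algebra_simps image_subset_iff)
  have inj: "x = 0" if x: "x \<in> E" "x - B x = 0" for x
  proof (rule nrm_zero_if_tendsto)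
    have "(B ^^ n) x = x" for n using x by (induction n) auto
    then show "nrm x \<le> (M * nrm x) * q ^ n" for n
      using pow[OF x(1), of n] by (simp add: algebra_simps)
    show "(\<lambda>n. (M * nrm x) * q ^ n) \<longlonglongrightarrow> 0" using q by (rule geometric_tendsto_zero)
  qed fact
  have surj: "\<exists>x\<in>E. x - B x = y \<and> nrm x \<le> M / (1 - q) * nrm y" if y: "y \<in> E" for y
  proof -
    have "nrm ((B ^^ k) y) \<le> (M * nrm y) * q ^ k" for k
      using pow[OF y, of k] by (simp add: algebra_simps)
    then obtain s where s: "s \<in> E" "(\<lambda>n. nrm ((\<Sum>k<n. (B ^^ k) y) - s)) \<longlonglongrightarrow> 0"
        "nrm s \<le> (M * nrm y) / (1 - q)"
      using geometric_series_converges[of "\<lambda>k. (B ^^ k) y" "M * nrm y" q] mem[OF y] q by metis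
    define p where "p n = (\<Sum>k<n. (B ^^ k) y)" for n
    have p: "p n \<in> E" for n unfolding p_def by (intro sum_mem mem y)
    have Bp: "p n - B (p n) = y - (B ^^ n) y" for n
    proof -
      have "B (p n) = (\<Sum>k<n. (B ^^ Suc k) y)"
        unfolding p_def by (subst linear_op_sum[OF lin]) (auto simp: mem y)
      then show ?thesis
        using sum_lessThan_telescope'[of "\<lambda>k. (B ^^ k) y" n] by (simp add: p_def sum_subtractf)
    qed
    have "s - B s - y = 0"
    proof (rule nrm_zero_if_tendsto)
      show in_E: "s - B s - y \<in> E" using s y lin by (simp add: diff_mem linear_op_mem)
      fix n
      define d where "d = p n - s"
      have d: "d \<in> E" using p s by (simp add: d_def diff_mem)
      have Bd: "B (p n - s) = B (p n) - B s" using linear_op_diff[OF lin p s(1)] .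
      have eq: "s - B s - y = (B d - d) - (B ^^ n) y"
        using Bp[of n] by (simp add: d_def Bd algebra_simps)
      have "nrm (s - B s - y) \<le> nrm (B d - d) + nrm ((B ^^ n) y)"
        unfolding eq by (intro nrm_diff_triangle diff_mem linear_op_mem[OF lin] mem d y)
      also have "nrm (B d - d) \<le> nrm (B d) + nrm d"
        by (intro nrm_diff_triangle linear_op_mem[OF lin] d)
      also have "nrm (B d) \<le> K * nrm d" using K d by blast
      also have "nrm ((B ^^ n) y) \<le> (M * nrm y) * q ^ n" using pow[OF y, of n] by (simp add: algebra_simps)
      finally show "nrm (s - B s - y) \<le> K * nrm (p n - s) + nrm (p n - s) + (M * nrm y) * q ^ n"
        by (simp only: d_def)
    next
      have "(\<lambda>n. K * nrm (p n - s) + nrm (p n - s) + (M * nrm y) * q ^ n) \<longlonglongrightarrow> K * 0 + 0 + 0"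
        using s(2) q unfolding p_def[symmetric] by (intro tendsto_intros geometric_tendsto_zero)
      then show "(\<lambda>n. K * nrm (p n - s) + nrm (p n - s) + (M * nrm y) * q ^ n) \<longlonglongrightarrow> 0" by simp
    qed
    then show ?thesis using s by (intro bexI[of _ s]) auto
  qed
  show thesis
    by (rule bounded_inverse[OF linear inj surj]) (use that in auto)
qed

section \<open>Resolvent sets\<close>

text \<open>The factorisation T - m = (T - l) (I - (m - l) R), where R inverts T - l, reduces the openness
  of the resolvent set to a Neumann series in (m - l) R.\<close>

lemma resolvent_open:
  assumes T: "linear_op_on E T" and l: "l \<notin> spectrum_on E nrm T"
  obtains e where "e > 0" "\<And>m. cmod (m - l) < e \<Longrightarrow> m \<notin> spectrum_on E nrm T"
proof -
  obtain R where R: "bounded_op_on E nrm R"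
      and RT: "\<And>x. x \<in> E \<Longrightarrow> R (T x - seq_scale l x) = x"
      and TR: "\<And>x. x \<in> E \<Longrightarrow> T (R x) - seq_scale l (R x) = x"
    using l unfolding not_in_spectrum_iff by blast
  obtain K where K: "K > 0" "\<And>x. x \<in> E \<Longrightarrow> nrm (R x) \<le> K * nrm x"
    by (rule bounded_op_bound[OF R]) blast
  note linR = bounded_op_on_linear[OF R]
  have "m \<notin> spectrum_on E nrm T" if m: "cmod (m - l) < 1 / K" for m
  proof -
    define B where "B x = seq_scale (m - l) (R x)" for x
    define q where "q = cmod (m - l) * K"
    have q: "0 \<le> q" "q < 1" using m K by (auto simp: q_def field_simps)
    have B: "bounded_op_on E nrm B"
      unfolding B_def by (rule bounded_op_compose[OF bounded_op_scale R])
    note linB = bounded_op_on_linear[OF B]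
    have step: "nrm (B x) \<le> q * nrm x" if "x \<in> E" for x
      using mult_left_mono[OF K(2)[OF that], of "cmod (m - l)"] that linR
      by (simp add: B_def q_def nrm_scale linear_op_mem mult.assoc)
    have pow: "nrm ((B ^^ n) x) \<le> 1 * q ^ n * nrm x" if x: "x \<in> E" for n x
    proof (induction n)
      case (Suc n)
      have "(B ^^ n) x \<in> E"
        using linear_op_mem[OF bounded_op_on_linear[OF bounded_op_funpow[OF B]] x] .
      from step[OF this] mult_left_mono[OF Suc q(1)] show ?case
        by (simp add: mult.assoc)
    qed simp
    obtain G where G: "bounded_op_on E nrm G"
      "\<And>x. x \<in> E \<Longrightarrow> G (x - B x) = x" "\<And>x. x \<in> E \<Longrightarrow> G x - B (G x) = x"
      using neumann_inverse[OF B pow q] by blast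
    note memG = linear_op_mem[OF bounded_op_on_linear[OF G(1)]]
    have "R (G (T x - seq_scale m x)) = x" if x: "x \<in> E" for x
    proof -
      define u where "u = T x - seq_scale l x"
      have u: "u \<in> E" using x T by (simp add: u_def diff_mem linear_op_mem scale_mem)
      have "T x - seq_scale m x = u - B u"
        using RT[OF x] by (simp add: B_def u_def fun_eq_iff algebra_simps)
      then show ?thesis using RT[OF x] by (simp only: G(2)[OF u]) (simp only: u_def)
    qed
    moreover have "T (R (G x)) - seq_scale m (R (G x)) = x" if x: "x \<in> E" for x
    proof -
      have "T (R (G x)) - seq_scale m (R (G x)) = G x - B (G x)"
        using TR[OF memG[OF x]] by (simp add: B_def fun_eq_iff algebra_simps)
      then show ?thesis using G(3)[OF x] by simp
    qed
    ultimately show ?thesis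
      unfolding not_in_spectrum_iff using bounded_op_compose[OF R G(1)] by blast
  qed
  then show thesis using that[of "1 / K"] K by simp
qed

lemma not_in_spectrum_if_power_bound:
  assumes T: "bounded_op_on E nrm T"
    and pow: "\<And>n x. x \<in> E \<Longrightarrow> nrm ((T ^^ n) x) \<le> M * r ^ n * nrm x"
    and r: "0 \<le> r" "r < cmod m"
  shows "m \<notin> spectrum_on E nrm T"
proof -
  define B where "B x = seq_scale (1 / m) (T x)" for x
  have m: "m \<noteq> 0" using r by auto
  have B: "bounded_op_on E nrm B"
    unfolding B_def by (rule bounded_op_compose[OF bounded_op_scale T])
  note linT = bounded_op_on_linear[OF T]
  have mem: "(T ^^ n) x \<in> E" if "x \<in> E" for n x
    using linear_op_mem[OF bounded_op_on_linear[OF bounded_op_funpow[OF T]]] that by blast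
  have Bpow: "(B ^^ n) x = seq_scale ((1 / m) ^ n) ((T ^^ n) x)" if "x \<in> E" for n x
    using mem[OF that] by (induction n) (auto simp: B_def linear_op_scale[OF linT] mult.commute)
  have bound: "nrm ((B ^^ n) x) \<le> M * (r / cmod m) ^ n * nrm x" if x: "x \<in> E" for n x
    using pow[OF x, of n] m
    by (simp add: Bpow x nrm_scale mem norm_power norm_divide power_divide field_simps)
  have q: "0 \<le> r / cmod m" "r / cmod m < 1" using r m by auto
  obtain G where G: "bounded_op_on E nrm G"
      "\<And>x. x \<in> E \<Longrightarrow> G (x - B x) = x" "\<And>x. x \<in> E \<Longrightarrow> G x - B (G x) = x"
    using neumann_inverse[OF B bound q] by blast
  note linG = bounded_op_on_linear[OF G(1)]
  have factor: "T x - seq_scale m x = seq_scale (- m) (x - B x)" for x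
    using m by (simp add: B_def fun_eq_iff algebra_simps)
  have "seq_scale (- 1 / m) (G (T x - seq_scale m x)) = x" if x: "x \<in> E" for x
  proof -
    have "x - B x \<in> E" using x bounded_op_on_linear[OF B] by (simp add: diff_mem linear_op_mem)
    then have "G (T x - seq_scale m x) = seq_scale (- m) x"
      unfolding factor by (simp only: linear_op_scale[OF linG] G(2)[OF x])
    then show ?thesis using m by (simp add: fun_eq_iff)
  qed
  moreover have "T (seq_scale (- 1 / m) (G x)) - seq_scale m (seq_scale (- 1 / m) (G x)) = x"
    if x: "x \<in> E" for x
    unfolding factor
    using arg_cong[OF G(3)[OF x], of "\<lambda>v. v"] m linear_op_mem[OF linG x]
    by (simp add: linear_op_scale[OF bounded_op_on_linear[OF B]] fun_eq_iff algebra_simps)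
  ultimately show ?thesis
    unfolding not_in_spectrum_iff using bounded_op_compose[OF bounded_op_scale G(1)] by blast
qed

text \<open>The spectral radius is a supremum of real numbers, which means nothing unless the spectrum is
  bounded; hence this lemma, and hence the need to know that the shifts are bounded operators.\<close>

lemma spectrum_bounded:
  assumes T: "bounded_op_on E nrm T"
  shows "bdd_above (cmod ` spectrum_on E nrm T)"
proof -
  obtain K where K: "K > 0" "\<And>x. x \<in> E \<Longrightarrow> nrm (T x) \<le> K * nrm x"
    by (rule bounded_op_bound[OF T]) blast
  have pow: "nrm ((T ^^ n) x) \<le> 1 * K ^ n * nrm x" if x: "x \<in> E" for n x
  proof (induction n)
    case (Suc n)
    have "(T ^^ n) x \<in> E"
      using linear_op_mem[OF bounded_op_on_linear[OF bounded_op_funpow[OF T]] x] .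
    from K(2)[OF this] mult_left_mono[OF Suc less_imp_le[OF K(1)]] show ?case
      by (simp add: mult.assoc)
  qed simp
  show ?thesis
  proof (rule bdd_aboveI2)
    fix m assume "m \<in> spectrum_on E nrm T"
    then show "cmod m \<le> K"
      using not_in_spectrum_if_power_bound[OF T pow, of m] K(1) by (meson less_imp_le not_le)
  qed
qed

section \<open>The closed graph theorem\<close>

text \<open>The category argument: E is the union of the closures of the sets on which T is at most k, so one
  of these closures contains a ball, and differences of elements of that ball fill a ball around 0.
  This bounds T only on a dense subset of each ball.\<close>

lemma coordinatewise_bounded_imp_almost_bounded:
  assumes T: "linear_op_on E T"
  obtains K where "K > 0" "\<And>x e. \<lbrakk>x \<in> E; e > 0\<rbrakk> \<Longrightarrow> \<exists>w\<in>E. nrm (x - w) < e \<and> nrm (T w) \<le> K * nrm x"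
proof -
  define A where "A k = {x \<in> E. nrm (T x) \<le> real k}" for k :: nat
  define \<G> where "\<G> = range (\<lambda>k. mtopology closure_of A k)"
  have sub: "A k \<subseteq> mtopology closure_of A k" for k
    by (rule closure_of_subset) (auto simp: A_def)
  have "x \<in> \<Union>\<G>" if "x \<in> E" for x
  proof -
    obtain k where "nrm (T x) \<le> real k" using real_arch_simple by blast
    then have "x \<in> mtopology closure_of A k" using that sub[of k] by (auto simp: A_def)
    then show ?thesis by (auto simp: \<G>_def)
  qed
  moreover have "\<Union>\<G> \<subseteq> E"
    using closure_of_subset_topspace[of mtopology] unfolding \<G>_def topspace_mtopology by auto
  ultimately have "\<Union>\<G> = topspace mtopology" by auto
  then have "mtopology interior_of \<Union>\<G> = E" using interior_of_topspace[of mtopology] by simp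
  then have "mtopology interior_of \<Union>\<G> \<noteq> {}" using zero_mem by blast
  moreover have "countable \<G>" by (simp add: \<G>_def)
  ultimately obtain C where "C \<in> \<G>" "\<not> (closedin mtopology C \<and> mtopology interior_of C = {})"
    using metric_Baire_category_alt[OF complete, of \<G>] by blast
  then obtain k where k: "mtopology interior_of (mtopology closure_of A k) \<noteq> {}"
    unfolding \<G>_def using closedin_closure_of by blast
  then obtain a r where a: "a \<in> E" "r > 0" "mball a r \<subseteq> mtopology closure_of A k"
    using in_interior_of_mball by blast
  have approx: "\<exists>u\<in>A k. nrm (x - u) < e" if "x \<in> E" "nrm (a - x) < r" "e > 0" for x e
  proof -
    have "x \<in> mball a r" using that a(1) by (simp add: in_mball seq_dist_def)
    then obtain u where u: "u \<in> A k" "u \<in> mball x e"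
      using a(3) \<open>e > 0\<close> unfolding metric_closure_of by blast
    then have "u \<in> E" by (simp add: A_def)
    with u that show ?thesis by (intro bexI[of _ u]) (simp_all add: in_mball seq_dist_def)
  qed
  have small: "\<exists>w\<in>E. nrm (x - w) < e \<and> nrm (T w) \<le> 2 * real k" if x: "x \<in> E" "nrm x < r" and e: "e > 0" for x e
  proof -
    obtain u where u: "u \<in> A k" "nrm (a + x - u) < e / 2"
      using approx[of "a + x" "e / 2"] x a(1) e nrm_uminus[OF x(1)] by (auto simp: add_mem)
    obtain v where v: "v \<in> A k" "nrm (a - v) < e / 2"
      using approx[of a "e / 2"] a(1,2) e by auto
    have uv: "u \<in> E" "v \<in> E" using u v by (auto simp: A_def)
    have "nrm (x - (u - v)) = nrm ((a + x - u) - (a - v))"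
      by (simp only: diff_diff_eq2 add_diff_eq diff_add_eq add_diff_cancel_left' diff_diff_eq) (simp add: algebra_simps)
    also have "\<dots> \<le> nrm (a + x - u) + nrm (a - v)"
      using uv x a(1) by (intro nrm_diff_triangle diff_mem add_mem)
    finally have "nrm (x - (u - v)) < e" using u v by linarith
    moreover have "nrm (T (u - v)) \<le> nrm (T u) + nrm (T v)"
      unfolding linear_op_diff[OF T uv] by (intro nrm_diff_triangle linear_op_mem[OF T] uv)
    ultimately show ?thesis
      using u v uv by (intro bexI[of _ "u - v"]) (auto simp: A_def diff_mem)
  qed
  define K where "K = 4 * real k / r + 1"
  have "\<exists>w\<in>E. nrm (x - w) < e \<and> nrm (T w) \<le> K * nrm x" if x: "x \<in> E" and e: "e > 0" for x e
  proof (cases "x = 0")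
    case True
    then show ?thesis using e zero_mem linear_op_zero[OF T] by (intro bexI[of _ 0]) auto
  next
    case False
    then have pos: "nrm x > 0" using nrm_eq_0[OF x] nrm_nonneg[OF x] by linarith
    \<comment> \<open>rescale x to norm r / 2\<close>
    define c where "c = r / (2 * nrm x)"
    have c: "c > 0" using pos a(2) by (simp add: c_def)
    have "nrm (seq_scale (complex_of_real c) x) < r"
      using pos a(2) c by (simp add: nrm_scale x) (simp add: c_def)
    then obtain w where w: "w \<in> E" "nrm (seq_scale (complex_of_real c) x - w) < e * c" "nrm (T w) \<le> 2 * real k"
      using small[of "seq_scale (complex_of_real c) x" "e * c"] x e c by (auto simp: scale_mem)
    let ?w = "seq_scale (complex_of_real (1 / c)) w"
    have "x - ?w = seq_scale (complex_of_real (1 / c)) (seq_scale (complex_of_real c) x - w)"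
      using c by (simp add: fun_eq_iff algebra_simps)
    then have "nrm (x - ?w) = nrm (seq_scale (complex_of_real c) x - w) / c"
      using c w x by (simp only: nrm_scale diff_mem scale_mem) (simp add: norm_divide)
    then have "nrm (x - ?w) < e" using w c by (simp add: divide_less_eq)
    moreover have "nrm (T ?w) = nrm (T w) / c"
      using c w T by (simp only: linear_op_scale nrm_scale linear_op_mem) (simp add: norm_divide)
    then have "nrm (T ?w) \<le> 2 * real k / c" using w c by (simp add: divide_right_mono)
    then have "nrm (T ?w) \<le> K * nrm x" using a(2) pos by (simp add: c_def K_def algebra_simps)
    ultimately show ?thesis using w by (intro bexI[of _ ?w]) (auto simp: scale_mem)
  qed
  moreover have "K > 0" using a(2) by (simp add: K_def add_nonneg_pos)
  ultimately show thesis using that by blast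
qed

text \<open>A closed graph theorem in which continuity of the coordinates of T plays the part of the closed
  graph. Successive approximation writes x as a series of vectors on which T is bounded;
  the images sum to some s, and comparing coordinates identifies s with T x.\<close>

lemma coordinatewise_bounded_imp_bounded:
  assumes T: "linear_op_on E T"
    and coord: "\<And>n. \<exists>C. \<forall>x\<in>E. cmod (x n) \<le> C * nrm x"
    and Tcoord: "\<And>n. \<exists>C. \<forall>x\<in>E. cmod (T x n) \<le> C * nrm x"
  shows "bounded_op_on E nrm T"
proof -
  obtain K where K: "K > 0"
      "\<And>x e. \<lbrakk>x \<in> E; e > 0\<rbrakk> \<Longrightarrow> \<exists>w\<in>E. nrm (x - w) < e \<and> nrm (T w) \<le> K * nrm x"
    using coordinatewise_bounded_imp_almost_bounded[OF T] by blast
  have "nrm (T x) \<le> 2 * K * nrm x" if x: "x \<in> E" for x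
  proof (cases "x = 0")
    case True
    then show ?thesis by (simp add: linear_op_zero[OF T])
  next
    case False
    define c where "c = nrm x"
    have c: "c > 0" using nrm_eq_0[OF x] nrm_nonneg[OF x] False unfolding c_def by linarith
    have "\<exists>w\<in>E. nrm (y - w) < c * (1/2) ^ Suc k \<and> nrm (T w) \<le> K * nrm y" if "y \<in> E" for y k
      by (rule K(2)[OF that]) (use c in simp)
    then obtain W where W: "\<And>y k. y \<in> E \<Longrightarrow>
        W y k \<in> E \<and> nrm (y - W y k) < c * (1/2) ^ Suc k \<and> nrm (T (W y k)) \<le> K * nrm y"
      by metis
    \<comment> \<open>X k is the error that remains after k approximations; it is at most c / 2 ^ k.\<close>
    define X where "X = rec_nat x (\<lambda>k y. y - W y k)"
    have X0: "X 0 = x" and XSuc: "X (Suc k) = X k - W (X k) k" for k by (simp_all add: X_def)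
    have X: "X k \<in> E" for k
    proof (induction k)
      case 0
      then show ?case unfolding X0 by (rule x)
    next
      case (Suc k)
      then show ?case unfolding XSuc using W by (intro diff_mem) blast+
    qed
    have nX: "nrm (X k) \<le> c * (1/2) ^ k" for k
    proof (cases k)
      case 0
      then show ?thesis by (simp add: X0 c_def)
    next
      case (Suc j)
      then show ?thesis using W[OF X[of j], of j] unfolding Suc XSuc by linarith
    qed
    define f where "f k = T (W (X k) k)" for k
    have f: "f k \<in> E" for k unfolding f_def using W[OF X] by (intro linear_op_mem[OF T]) blast
    have nf: "nrm (f k) \<le> (K * c) * (1/2) ^ k" for k
      using W[OF X[of k], of k] mult_left_mono[OF nX[of k] less_imp_le[OF K(1)]]
      unfolding f_def by (simp only: mult.assoc) linarith
    obtain s where s: "s \<in> E" "(\<lambda>n. nrm ((\<Sum>k<n. f k) - s)) \<longlonglongrightarrow> 0" "nrm s \<le> (K * c) / (1 - 1/2)"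
      using geometric_series_converges[OF f nf] by auto
    have partial: "(\<Sum>k<n. f k) = T x - T (X n)" for n
    proof (induction n)
      case 0
      then show ?case by (simp add: X0)
    next
      case (Suc n)
      have "T (X (Suc n)) = T (X n) - f n"
        unfolding XSuc f_def using W[OF X] by (intro linear_op_diff[OF T X]) blast
      then show ?case unfolding sum.lessThan_Suc Suc.IH by (simp add: fun_eq_iff)
    qed
    have "T x = s"
    proof
      fix m
      obtain C where C: "\<And>x. x \<in> E \<Longrightarrow> cmod (x m) \<le> C * nrm x" using coord by blast
      obtain D where D: "\<And>x. x \<in> E \<Longrightarrow> cmod (T x m) \<le> D * nrm x" using Tcoord by blast
      have lim: "(\<lambda>n. C * nrm ((\<Sum>k<n. f k) - s) + (\<bar>D\<bar> * c) * (1/2) ^ n) \<longlonglongrightarrow> C * 0 + 0"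
        by (intro tendsto_intros s(2) geometric_tendsto_zero) auto
      have "cmod (T x m - s m) \<le> C * nrm ((\<Sum>k<n. f k) - s) + (\<bar>D\<bar> * c) * (1/2) ^ n" for n
      proof -
        have "T x m - s m = ((\<Sum>k<n. f k) - s) m + T (X n) m"
          using fun_cong[OF partial[of n], of m] by simp
        then have "cmod (T x m - s m) \<le> cmod (((\<Sum>k<n. f k) - s) m) + cmod (T (X n) m)"
          by (metis norm_triangle_ineq)
        also have "cmod (((\<Sum>k<n. f k) - s) m) \<le> C * nrm ((\<Sum>k<n. f k) - s)"
          by (intro C diff_mem sum_mem f s)
        also have "cmod (T (X n) m) \<le> \<bar>D\<bar> * (c * (1/2) ^ n)"
          using D[OF X[of n]] mult_mono[of D "\<bar>D\<bar>" "nrm (X n)" "c * (1/2) ^ n"] nX[of n] nrm_nonneg[OF X[of n]]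
          by linarith
        finally show ?thesis by (simp only: mult.assoc)
      qed
      then have "cmod (T x m - s m) \<le> C * 0 + 0"
        using LIMSEQ_le_const[OF lim] by blast
      then show "T x m = s m" by simp
    qed
    then show ?thesis using s(3) by (simp add: c_def)
  qed
  then show ?thesis unfolding bounded_op_on_iff_linear using T by blast
qed

end

section \<open>Rotations and averages over roots of unity\<close>

definition unit_seq :: "nat \<Rightarrow> cseq" where
  "unit_seq j = (\<lambda>n. if n = j then 1 else 0)"

lemma unit_seq_apply: "unit_seq j n = (if n = j then 1 else 0)"
  by (simp add: unit_seq_def)

lemma unit_seq_finite: "unit_seq j \<in> finite_seqs"
  by (simp add: finite_seqs_def unit_seq_def)

lemma finite_seqs_support:
  assumes "x \<in> finite_seqs" obtains L where "\<And>n. n \<ge> L \<Longrightarrow> x n = 0"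
proof -
  obtain m where "\<forall>n\<in>{n. x n \<noteq> 0}. n < m"
    using assms unfolding finite_seqs_def finite_nat_set_iff_bounded by blast
  then show thesis using that[of m] by fastforce
qed

lemma finite_seqsI:
  assumes "\<And>n. n \<ge> L \<Longrightarrow> x n = 0" shows "x \<in> finite_seqs"
  unfolding finite_seqs_def mem_Collect_eq
  by (rule finite_subset[of _ "{..<L}"]) (use assms not_less in auto)

lemma finite_seq_expansion:
  assumes "\<And>n. n \<ge> L \<Longrightarrow> x n = 0"
  shows "x = (\<Sum>j<L. seq_scale (x j) (unit_seq j))"
proof
  fix n
  have "(\<Sum>j<L. seq_scale (x j) (unit_seq j)) n = (\<Sum>j<L. if j = n then x n else 0)"
    unfolding seq_sum_apply by (intro sum.cong) (auto simp: unit_seq_apply)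
  also have "\<dots> = x n" using assms[of n] by (simp add: not_less)
  finally show "x n = (\<Sum>j<L. seq_scale (x j) (unit_seq j)) n" by simp
qed

text \<open>The coordinates whose index is congruent to m modulo N are kept and all others are killed, by
  orthogonality of the characters of the cyclic group of order N. The exponent m is an integer
  because diagonals on either side of the main one have to be reached.\<close>

definition root_average :: "nat \<Rightarrow> int \<Rightarrow> cseq \<Rightarrow> cseq" where
  "root_average N m u = seq_scale (1 / of_nat N)
     (\<Sum>i<N. seq_scale ((cis (2 * pi / N) ^ i) powi (- m)) (rotation (cis (2 * pi / N) ^ i) u))"

lemma sum_roots_of_unity_powi:
  assumes "s \<noteq> 0" "\<bar>s\<bar> < int N"
  shows "(\<Sum>i<N. (cis (2 * pi / N) ^ i) powi s) = 0"
proof -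
  define w where "w = cis (2 * pi / N) powi s"
  have N: "N > 0" using assms by auto
  have w: "w = cis (of_int s * (2 * pi / N))" by (simp add: w_def cis_power_int)
  have "w ^ N = cis (2 * pi * of_int s)" using N by (simp add: w Complex.DeMoivre mult_ac)
  then have wN: "w ^ N = 1" by simp
  have "w \<noteq> 1"
  proof
    assume "w = 1"
    then have "cos (of_int s * (2 * pi / N)) = 1" by (metis cis.sel(1) one_complex.sel(1) w)
    then obtain n :: int where "of_int s * (2 * pi / N) = of_int n * 2 * pi"
      unfolding cos_one_2pi_int by blast
    then have "real_of_int s = of_int (n * int N)" using N by (simp add: field_simps)
    then have "s = n * int N" using of_int_eq_iff by blast
    with assms show False
      by (metis abs_mult abs_of_nat dvd_imp_le_int dvd_triv_right linorder_not_less)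
  qed
  have eq: "(cis (2 * pi / N) ^ i) powi s = w ^ i" for i
    by (simp add: w_def flip: power_int_of_nat power_int_mult) (simp add: mult.commute)
  have "(w - 1) * (\<Sum>i<N. w ^ i) = 0" using wN power_diff_1_eq[of w N] by simp
  with \<open>w \<noteq> 1\<close> show ?thesis by (simp add: eq)
qed

lemma root_average_apply:
  "root_average N m u k = (1 / of_nat N) * (\<Sum>i<N. (cis (2 * pi / N) ^ i) powi (int k - m)) * u k"
proof -
  have "(cis (2 * pi / N) ^ i) powi (- m) * ((cis (2 * pi / N) ^ i) ^ k * u k)
      = (cis (2 * pi / N) ^ i) powi (int k - m) * u k" for i
    using power_int_add[of "cis (2 * pi / N) ^ i" "- m" "int k"] by simp
  then have "(\<Sum>i<N. (cis (2 * pi / N) ^ i) powi (- m) * ((cis (2 * pi / N) ^ i) ^ k * u k))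
      = (\<Sum>i<N. (cis (2 * pi / N) ^ i) powi (int k - m)) * u k"
    unfolding sum_distrib_right by (intro sum.cong refl)
  then show ?thesis
    unfolding root_average_def seq_scale_apply seq_sum_apply rotation_def by (simp only: mult.assoc)
qed

text \<open>For negative m this is 0: an integer index that leaves the non-negative integers carries nothing.\<close>

definition coordinate_part :: "int \<Rightarrow> cseq \<Rightarrow> cseq" where
  "coordinate_part m u = (\<lambda>k. if int k = m then u k else 0)"

lemma root_average_finite:
  assumes "\<And>n. n \<ge> L \<Longrightarrow> u n = 0" and N: "int N > int L + \<bar>m\<bar>"
  shows "root_average N m u = coordinate_part m u"
proof
  fix k
  show "root_average N m u k = coordinate_part m u k"
  proof (cases "k < L \<and> int k \<noteq> m")
    case True
    then have "(\<Sum>i<N. (cis (2 * pi / N) ^ i) powi (int k - m)) = 0"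
      using N by (intro sum_roots_of_unity_powi) auto
    with True show ?thesis by (simp only: root_average_apply coordinate_part_def) simp
  next
    case False
    then show ?thesis using assms(1)[of k] N by (auto simp: root_average_apply coordinate_part_def)
  qed
qed

lemma coordinate_part_eq:
  "coordinate_part m u = (if 0 \<le> m then seq_scale (u (nat m)) (unit_seq (nat m)) else 0)"
  by (auto simp: coordinate_part_def unit_seq_def fun_eq_iff)

context rotation_banach_seq_space
begin

lemma finite_mem: "x \<in> finite_seqs \<Longrightarrow> x \<in> E"
  using finite_seqs_subset by blast

lemma unit_seq_mem: "unit_seq j \<in> E"
  by (intro finite_mem unit_seq_finite)

lemma finite_approx:
  assumes "x \<in> E" "e > 0"
  obtains f where "f \<in> finite_seqs" "nrm (x - f) < e"
proof -
  have "x \<in> mtopology closure_of finite_seqs" using assms finite_seqs_dense by blast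
  then obtain f where f: "f \<in> finite_seqs" "f \<in> mball x e"
    using assms unfolding metric_closure_of by blast
  then show thesis using that[of f] finite_mem[of f] assms(1) by (simp add: in_mball seq_dist_def)
qed

text \<open>Continuity at 0 of a linear functional gives its boundedness, by rescaling.\<close>

lemma coordinate_bounded: "\<exists>C. \<forall>x\<in>E. cmod (x n) \<le> C * nrm x"
proof -
  have "open (ball (0::complex) 1)" by simp
  then obtain r where r: "r > 0" "\<And>x. x \<in> E \<Longrightarrow> seq_dist E nrm 0 x < r \<Longrightarrow> x n \<in> ball 0 1"
    using coordinate_continuous[of n] zero_mem unfolding continuous_map_from_metric
    by (metis (no_types, lifting) centre_in_ball open_openin zero_fun_apply zero_less_one)
  have small: "cmod (x n) < 1" if "x \<in> E" "nrm x < r" for x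
    using r(2)[OF that(1)] that zero_mem nrm_uminus[OF that(1)] by (simp add: seq_dist_def)
  have "cmod (x n) \<le> 2 / r * nrm x" if x: "x \<in> E" for x
  proof (cases "x = 0")
    case False
    then have pos: "nrm x > 0" using nrm_eq_0[OF x] nrm_nonneg[OF x] by linarith
    define c where "c = complex_of_real (r / (2 * nrm x))"
    have c: "cmod c = r / (2 * nrm x)" using pos r by (simp add: c_def norm_divide norm_mult)
    have "nrm (seq_scale c x) < r" using pos r by (simp only: nrm_scale[OF x] c) (simp add: field_simps)
    then have "cmod (seq_scale c x n) < 1" using small x scale_mem by blast
    then show ?thesis using pos r by (simp add: norm_mult c field_simps)
  qed simp
  then show ?thesis by blast
qed

definition rotation_bound :: real where
  "rotation_bound = (SOME C. C \<ge> 0 \<and> (\<forall>z. cmod z = 1 \<longrightarrow> (\<forall>x\<in>E. nrm (rotation z x) \<le> C * nrm x)))"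

lemma rotation_bound_nonneg: "rotation_bound \<ge> 0"
  and nrm_rotation: "cmod z = 1 \<Longrightarrow> x \<in> E \<Longrightarrow> nrm (rotation z x) \<le> rotation_bound * nrm x"
proof -
  obtain C where C: "\<And>z x. cmod z = 1 \<Longrightarrow> x \<in> E \<Longrightarrow> nrm (rotation z x) \<le> C * nrm x"
    using rotation_bounded by blast
  have "nrm (rotation z x) \<le> max C 0 * nrm x" if "cmod z = 1" "x \<in> E" for z x
    using C[OF that] mult_right_mono[of C "max C 0" "nrm x"] nrm_nonneg[OF that(2)] by linarith
  then have "\<exists>C. C \<ge> 0 \<and> (\<forall>z. cmod z = 1 \<longrightarrow> (\<forall>x\<in>E. nrm (rotation z x) \<le> C * nrm x))"
    by (intro exI[of _ "max C 0"]) auto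
  from someI_ex[OF this, folded rotation_bound_def]
  show "rotation_bound \<ge> 0"
    and "cmod z = 1 \<Longrightarrow> x \<in> E \<Longrightarrow> nrm (rotation z x) \<le> rotation_bound * nrm x" by blast+
qed

lemma bounded_op_rotation: "cmod z = 1 \<Longrightarrow> bounded_op_on E nrm (rotation z)"
  unfolding bounded_op_on_def
proof (intro conjI ballI allI)
  assume "cmod z = 1"
  then show "rotation z ` E \<subseteq> E" "\<exists>C. \<forall>x\<in>E. nrm (rotation z x) \<le> C * nrm x"
    using rotation_mem nrm_rotation by blast+
qed (simp_all add: rotation_def fun_eq_iff algebra_simps)

lemma cmod_root [simp]: "cmod (cis t ^ i) = 1"
  by (simp add: norm_power)

lemma nrm_scaled_average:
  assumes "\<And>i. i < N \<Longrightarrow> v i \<in> E" "\<And>i. i < N \<Longrightarrow> nrm (v i) \<le> c" "N > 0"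
  shows "nrm (seq_scale (1 / of_nat N) (\<Sum>i<N. v i)) \<le> c"
proof -
  have mem: "(\<Sum>i<N. v i) \<in> E" by (intro sum_mem) (use assms in auto)
  have "nrm (\<Sum>i<N. v i) \<le> (\<Sum>i<N. nrm (v i))" by (intro nrm_sum) (use assms in auto)
  also have "\<dots> \<le> (\<Sum>i<N. c)" by (intro sum_mono) (use assms in auto)
  finally have "nrm (\<Sum>i<N. v i) \<le> real N * c" by simp
  then show ?thesis using \<open>N > 0\<close> by (simp only: nrm_scale[OF mem]) (simp add: norm_divide field_simps)
qed

lemma twisted_rotation_bound:
  assumes "cmod z = 1" "x \<in> E"
  shows "seq_scale (z powi m) (rotation z x) \<in> E"
    "nrm (seq_scale (z powi m) (rotation z x)) \<le> rotation_bound * nrm x"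
  using assms nrm_rotation[OF assms]
  by (auto simp: scale_mem rotation_mem nrm_scale norm_power_int)

lemma root_average_mem: "u \<in> E \<Longrightarrow> root_average N m u \<in> E"
  unfolding root_average_def by (intro scale_mem sum_mem twisted_rotation_bound) auto

lemma nrm_root_average: "u \<in> E \<Longrightarrow> N > 0 \<Longrightarrow> nrm (root_average N m u) \<le> rotation_bound * nrm u"
  unfolding root_average_def by (intro nrm_scaled_average twisted_rotation_bound) auto

lemma root_average_diff: "root_average N m (u - v) = root_average N m u - root_average N m v"
  by (simp add: fun_eq_iff root_average_apply right_diff_distrib)

lemma coordinate_part_mem: "coordinate_part m u \<in> E"
  unfolding coordinate_part_eq by (simp add: scale_mem unit_seq_mem zero_mem)

text \<open>For finitely supported u the averages are constant in N from some point on; their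
  uniform bound and density carry the convergence over to all of E. The limit is taken in the norm of
  E: coordinatewise convergence alone would give no estimate of the norm of the limit.\<close>

lemma root_average_tendsto:
  assumes u: "u \<in> E"
  shows "(\<lambda>N. nrm (coordinate_part m u - root_average N m u)) \<longlonglongrightarrow> 0"
proof (rule LIMSEQ_I)
  fix r :: real assume r: "r > 0"
  obtain C where C: "\<And>x. x \<in> E \<Longrightarrow> cmod (x (nat m)) \<le> C * nrm x" using coordinate_bounded by blast
  \<comment> \<open>D bounds coordinate part and averages together; adding 1 makes it positive.\<close>
  define D where "D = \<bar>C\<bar> * nrm (unit_seq (nat m)) + rotation_bound + 1"
  have "\<bar>C\<bar> * nrm (unit_seq (nat m)) \<ge> 0" using nrm_nonneg[OF unit_seq_mem] by simp
  then have D: "D > 0" unfolding D_def using rotation_bound_nonneg by linarith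
  obtain f where f: "f \<in> finite_seqs" "nrm (u - f) < r / D"
    using finite_approx[OF u, of "r / D"] r D by auto
  obtain L where L: "\<And>n. n \<ge> L \<Longrightarrow> f n = 0" by (rule finite_seqs_support[OF f(1)]) blast
  define d where "d = u - f"
  have d: "d \<in> E" unfolding d_def using u finite_mem f by (simp add: diff_mem)
  have part: "nrm (coordinate_part m d) \<le> \<bar>C\<bar> * nrm (unit_seq (nat m)) * nrm d"
  proof (cases "m \<ge> 0")
    case True
    have "nrm (coordinate_part m d) = cmod (d (nat m)) * nrm (unit_seq (nat m))"
      using True by (simp add: coordinate_part_eq nrm_scale unit_seq_mem)
    also have "\<dots> \<le> (\<bar>C\<bar> * nrm d) * nrm (unit_seq (nat m))"
      using C[OF d] nrm_nonneg[OF unit_seq_mem] mult_right_mono[OF abs_ge_self[of C] nrm_nonneg[OF d]]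
      by (intro mult_right_mono) linarith+
    finally show ?thesis by (simp add: mult_ac)
  next
    case False
    then show ?thesis using nrm_nonneg[OF unit_seq_mem] nrm_nonneg[OF d] by (simp add: coordinate_part_eq)
  qed
  have "nrm (coordinate_part m u - root_average N m u) < r" if N: "N \<ge> Suc (L + nat \<bar>m\<bar>)" for N
  proof -
    have avg_f: "root_average N m f = coordinate_part m f"
      using N by (intro root_average_finite[OF L]) auto
    have "coordinate_part m d = coordinate_part m u - coordinate_part m f"
      by (auto simp: d_def coordinate_part_def fun_eq_iff)
    then have eq: "coordinate_part m u - root_average N m u = coordinate_part m d - root_average N m d"
      by (simp add: d_def root_average_diff avg_f)
    have "nrm (coordinate_part m u - root_average N m u)
        \<le> nrm (coordinate_part m d) + nrm (root_average N m d)"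
      unfolding eq by (intro nrm_diff_triangle coordinate_part_mem root_average_mem d)
    also have "\<dots> \<le> \<bar>C\<bar> * nrm (unit_seq (nat m)) * nrm d + rotation_bound * nrm d"
      using part nrm_root_average[OF d, of N m] N by simp
    also have "\<dots> \<le> D * nrm d" using nrm_nonneg[OF d] by (simp add: D_def algebra_simps)
    also have "\<dots> < r" using f(2) D unfolding d_def by (simp add: field_simps)
    finally show ?thesis .
  qed
  then show "\<exists>N0. \<forall>N\<ge>N0. norm (nrm (coordinate_part m u - root_average N m u) - 0) < r"
    using nrm_nonneg[OF diff_mem[OF coordinate_part_mem root_average_mem[OF u]]]
    by (intro exI[of _ "Suc (L + nat \<bar>m\<bar>)"]) auto
qed

end

section \<open>Diagonals of bounded operators\<close>

lemma rotation_apply: "rotation z x n = z ^ n * x n"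
  by (simp add: rotation_def)

text \<open>The operator whose matrix in the unit sequences is the d-th diagonal of the matrix of B and zero
  elsewhere; d counts downwards, so that the right shift has only the diagonal 1 and the left shift only
  the diagonal -1.\<close>

definition diagonal :: "int \<Rightarrow> (cseq \<Rightarrow> cseq) \<Rightarrow> cseq \<Rightarrow> cseq" where
  "diagonal d B x =
     (\<lambda>k. if d \<le> int k then B (unit_seq (nat (int k - d))) k * x (nat (int k - d)) else 0)"

lemma diagonal_eq_sum:
  assumes L: "\<forall>n\<ge>L. x n = 0"
  shows "diagonal d B x = (\<Sum>j<L. seq_scale (x j) (coordinate_part (d + int j) (B (unit_seq j))))"
proof
  fix k
  have "(\<Sum>j<L. seq_scale (x j) (coordinate_part (d + int j) (B (unit_seq j)))) k
      = (\<Sum>j<L. if int k = d + int j then x j * B (unit_seq j) k else 0)"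
    unfolding seq_sum_apply by (intro sum.cong) (auto simp: coordinate_part_def)
  also have "\<dots> = diagonal d B x k"
  proof (cases "d \<le> int k")
    case True
    define j where "j = nat (int k - d)"
    have "int k = d + int i \<longleftrightarrow> i = j" for i using True by (auto simp: j_def)
    then have "(\<Sum>i<L. if int k = d + int i then x i * B (unit_seq i) k else 0)
        = (\<Sum>i<L. if i = j then x i * B (unit_seq i) k else 0)"
      by (intro sum.cong) auto
    also have "\<dots> = x j * B (unit_seq j) k" using L by (simp add: not_less)
    finally show ?thesis using True by (simp add: diagonal_def j_def mult.commute)
  next
    case False
    then show ?thesis by (auto simp: diagonal_def intro!: sum.neutral)
  qed
  finally show "diagonal d B x k
      = (\<Sum>j<L. seq_scale (x j) (coordinate_part (d + int j) (B (unit_seq j)))) k" by simp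
qed

context rotation_banach_seq_space
begin

text \<open>Conjugating B by the rotation with parameter z multiplies the matrix entry in row k and
  column j by z ^ (k - j). The twisted average of the conjugates over the roots of unity therefore acts
  on the j-th column of B as the average that singles out the row d + j.\<close>

lemma conjugate_average_eq:
  assumes B: "linear_op_on E B" and L: "\<forall>n\<ge>L. x n = 0"
  shows "seq_scale (1 / of_nat N) (\<Sum>i<N. seq_scale ((cis (2 * pi / N) ^ i) powi (- d))
             (rotation (cis (2 * pi / N) ^ i) (B (rotation (inverse (cis (2 * pi / N) ^ i)) x))))
       = (\<Sum>j<L. seq_scale (x j) (root_average N (d + int j) (B (unit_seq j))))"
proof
  fix k
  define z where "z i = cis (2 * pi / N) ^ i" for i :: nat
  have z: "z i \<noteq> 0" for i by (simp add: z_def)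
  have B_rot: "B (rotation (inverse (z i)) x) = (\<Sum>j<L. seq_scale (inverse (z i) ^ j * x j) (B (unit_seq j)))" for i
  proof -
    have "rotation (inverse (z i)) x = (\<Sum>j<L. seq_scale (rotation (inverse (z i)) x j) (unit_seq j))"
      by (rule finite_seq_expansion) (simp add: rotation_def L)
    then have "B (rotation (inverse (z i)) x) = (\<Sum>j<L. B (seq_scale (rotation (inverse (z i)) x j) (unit_seq j)))"
      using linear_op_sum[OF B, of "{..<L}" "\<lambda>j. seq_scale (rotation (inverse (z i)) x j) (unit_seq j)"]
        scale_mem unit_seq_mem by metis
    also have "\<dots> = (\<Sum>j<L. seq_scale (inverse (z i) ^ j * x j) (B (unit_seq j)))"
      by (intro sum.cong refl) (simp only: linear_op_scale[OF B unit_seq_mem] rotation_def)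
    finally show ?thesis .
  qed
  have B_rot_apply: "B (rotation (inverse (z i)) x) k = (\<Sum>j<L. inverse (z i) ^ j * (x j * B (unit_seq j) k))" for i
    unfolding B_rot seq_sum_apply seq_scale_apply by (simp only: mult.assoc)
  have powers: "z i powi (- d) * (z i ^ k * (inverse (z i) ^ j * y)) = z i powi (int k - (d + int j)) * y" for i j y
  proof -
    have "z i powi (int k - (d + int j)) = z i powi (- d + int k + - int j)" by (simp add: algebra_simps)
    also have "\<dots> = z i powi (- d) * z i ^ k * inverse (z i) ^ j"
      unfolding power_int_add[OF disjI1[OF z]] by (simp add: power_int_minus power_inverse)
    finally show ?thesis by (simp add: mult.assoc)
  qed
  have "(\<Sum>i<N. seq_scale (z i powi (- d)) (rotation (z i) (B (rotation (inverse (z i)) x)))) k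
      = (\<Sum>i<N. \<Sum>j<L. z i powi (- d) * (z i ^ k * (inverse (z i) ^ j * (x j * B (unit_seq j) k))))"
    by (simp only: seq_sum_apply[of _ "{..<N}"] seq_scale_apply rotation_apply B_rot_apply sum_distrib_left mult.assoc)
  also have "\<dots> = (\<Sum>i<N. \<Sum>j<L. z i powi (int k - (d + int j)) * (x j * B (unit_seq j) k))"
    by (simp only: powers)
  also have "\<dots> = (\<Sum>j<L. x j * ((\<Sum>i<N. z i powi (int k - (d + int j))) * B (unit_seq j) k))"
    by (subst sum.swap) (simp add: sum_distrib_left sum_distrib_right mult_ac)
  finally show "seq_scale (1 / of_nat N) (\<Sum>i<N. seq_scale ((cis (2 * pi / N) ^ i) powi (- d))
             (rotation (cis (2 * pi / N) ^ i) (B (rotation (inverse (cis (2 * pi / N) ^ i)) x)))) k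
       = (\<Sum>j<L. seq_scale (x j) (root_average N (d + int j) (B (unit_seq j)))) k"
    unfolding z_def[symmetric] seq_scale_apply seq_sum_apply[of _ "{..<L}"] root_average_apply
    by (simp add: sum_distrib_left mult_ac)
qed

text \<open>Passing to a diagonal is, on finite sequences, a norm limit of averages of rotated conjugates
  of B, each of which is bounded by the bound of B times the square of the bound for the rotations.
  Finite sequences are needed because convergence is only known column by column.\<close>

lemma nrm_diagonal_le:
  assumes B: "linear_op_on E B" and bound: "\<And>x. x \<in> E \<Longrightarrow> nrm (B x) \<le> M * nrm x" and M: "M \<ge> 0"
    and x: "x \<in> finite_seqs"
  shows "nrm (diagonal d B x) \<le> rotation_bound * M * rotation_bound * nrm x"
proof -
  obtain L where L: "\<forall>n\<ge>L. x n = 0" using finite_seqs_support[OF x] by blast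
  define c where "c = rotation_bound * M * rotation_bound * nrm x"
  define V where "V N = (\<Sum>j<L. seq_scale (x j) (root_average N (d + int j) (B (unit_seq j))))" for N
  define err where "err N j = nrm (coordinate_part (d + int j) (B (unit_seq j))
      - root_average N (d + int j) (B (unit_seq j)))" for N j
  have xE: "x \<in> E" using x by (rule finite_mem)
  have BE: "B (unit_seq j) \<in> E" for j by (rule linear_op_mem[OF B unit_seq_mem])
  have V: "V N \<in> E" for N unfolding V_def by (intro sum_mem scale_mem root_average_mem BE)
  have D: "diagonal d B x \<in> E"
    unfolding diagonal_eq_sum[OF L] by (intro sum_mem scale_mem coordinate_part_mem)
  have nV: "nrm (V N) \<le> c" if N: "N > 0" for N
  proof -
    have unit: "cmod (inverse (cis (2 * pi / N) ^ i)) = 1" for i by (simp add: norm_inverse)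
    have mem: "B (rotation (inverse (cis (2 * pi / N) ^ i)) x) \<in> E" for i
      by (intro linear_op_mem[OF B] rotation_mem unit xE)
    have "nrm (B (rotation (inverse (cis (2 * pi / N) ^ i)) x)) \<le> M * (rotation_bound * nrm x)" for i
      using bound[OF rotation_mem[OF unit xE]] mult_left_mono[OF nrm_rotation[OF unit xE] M]
      by (rule order_trans)
    then have "rotation_bound * nrm (B (rotation (inverse (cis (2 * pi / N) ^ i)) x)) \<le> c" for i
      using mult_left_mono[OF _ rotation_bound_nonneg] unfolding c_def mult.assoc by blast
    then show ?thesis
      unfolding V_def conjugate_average_eq[OF B L, symmetric]
      using twisted_rotation_bound[OF cmod_root mem] N
      by (intro nrm_scaled_average) (blast intro: order_trans)+
  qed
  have close: "nrm (diagonal d B x - V N) \<le> (\<Sum>j<L. cmod (x j) * err N j)" for N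
  proof -
    have eq: "diagonal d B x - V N = (\<Sum>j<L. seq_scale (x j) (coordinate_part (d + int j) (B (unit_seq j))
        - root_average N (d + int j) (B (unit_seq j))))"
      unfolding diagonal_eq_sum[OF L] V_def sum_subtractf[symmetric]
      by (intro sum.cong refl) (simp add: fun_eq_iff algebra_simps)
    have mem: "coordinate_part (d + int j) (B (unit_seq j)) - root_average N (d + int j) (B (unit_seq j)) \<in> E" for j
      by (intro diff_mem coordinate_part_mem root_average_mem BE)
    show ?thesis
      unfolding eq err_def nrm_scale[OF mem, symmetric] by (intro nrm_sum scale_mem mem)
  qed
  have "nrm (diagonal d B x) \<le> c + (\<Sum>j<L. cmod (x j) * err N j)" if "N > 0" for N
    using nrm_le_add_diff[OF D V[of N]] nV[OF that] close[of N] by linarith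
  then have *: "nrm (diagonal d B x) \<le> c + (\<Sum>j<L. cmod (x j) * err (Suc N) j)" for N by blast
  have "(\<lambda>N. c + (\<Sum>j<L. cmod (x j) * err (Suc N) j)) \<longlonglongrightarrow> c + (\<Sum>j<L. cmod (x j) * 0)"
    unfolding err_def
    by (intro tendsto_intros LIMSEQ_Suc[OF root_average_tendsto[OF BE]])
  from LIMSEQ_le_const[OF this] * show ?thesis unfolding c_def by auto
qed

section \<open>Operators whose resolvent has the powers as diagonals\<close>

lemma bound_extends_from_finite:
  assumes P: "bounded_op_on E nrm P" and fin: "\<And>f. f \<in> finite_seqs \<Longrightarrow> nrm (P f) \<le> M * nrm f"
    and x: "x \<in> E"
  shows "nrm (P x) \<le> M * nrm x"
proof -
  obtain K where K: "K > 0" "\<And>x. x \<in> E \<Longrightarrow> nrm (P x) \<le> K * nrm x"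
    by (rule bounded_op_bound[OF P]) blast
  note lin = bounded_op_on_linear[OF P]
  have "nrm (P x) \<le> M * nrm x + (\<bar>M\<bar> + K) * (1 / real (Suc n))" for n
  proof -
    obtain f where f: "f \<in> finite_seqs" "nrm (x - f) < 1 / real (Suc n)"
      by (rule finite_approx[OF x, of "1 / real (Suc n)"]) simp
    have fE: "f \<in> E" and d: "x - f \<in> E" using f x finite_mem diff_mem by auto
    have split: "nrm (P x) \<le> nrm (P f) + nrm (P x - P f)"
      by (intro nrm_le_add_diff linear_op_mem[OF lin] x fE)
    have diff: "nrm (P x - P f) \<le> K * nrm (x - f)"
      unfolding linear_op_diff[OF lin x fE, symmetric] by (rule K(2)[OF d])
    have at_f: "nrm (P f) \<le> M * nrm f" by (rule fin[OF f(1)])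
    have shift: "M * nrm f \<le> M * nrm x + \<bar>M\<bar> * nrm (x - f)"
    proof -
      have "\<bar>nrm f - nrm x\<bar> \<le> nrm (x - f)"
        using nrm_le_add_diff[OF x fE] nrm_le_add_diff[OF fE x] nrm_diff_commute[OF x fE] by linarith
      then have "\<bar>M\<bar> * \<bar>nrm f - nrm x\<bar> \<le> \<bar>M\<bar> * nrm (x - f)" by (intro mult_left_mono) auto
      then have "M * (nrm f - nrm x) \<le> \<bar>M\<bar> * nrm (x - f)"
        using abs_ge_self[of "M * (nrm f - nrm x)"] unfolding abs_mult by linarith
      then show ?thesis by (simp only: right_diff_distrib)
    qed
    have "nrm (P x) \<le> M * nrm x + (\<bar>M\<bar> + K) * nrm (x - f)"
      unfolding distrib_right using split diff at_f shift by linarith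
    also have "(\<bar>M\<bar> + K) * nrm (x - f) \<le> (\<bar>M\<bar> + K) * (1 / real (Suc n))"
      using f(2) K(1) by (intro mult_left_mono) auto
    finally show ?thesis by linarith
  qed
  moreover have "(\<lambda>n. M * nrm x + (\<bar>M\<bar> + K) * (1 / real (Suc n))) \<longlonglongrightarrow> M * nrm x + (\<bar>M\<bar> + K) * 0"
    using LIMSEQ_inverse_real_of_nat by (intro tendsto_intros) (simp add: inverse_eq_divide)
  ultimately show ?thesis using LIMSEQ_le_const by force
qed

text \<open>In the applications R inverts T - l. The formal expansion of R is the sum of
  - T ^ n / l ^ (n + 1); when T moves every unit sequence by one step, the n-th term is a single diagonal of R,
  so a single bounded R controls all the powers of T at once.\<close>

lemma power_bound_of_resolvent:
  assumes T: "bounded_op_on E nrm T" and R: "bounded_op_on E nrm R" and l: "l \<noteq> 0"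
    and diag: "\<And>n x. x \<in> finite_seqs \<Longrightarrow>
      diagonal (d n) R x = seq_scale (- ((1 / l) ^ Suc n)) ((T ^^ n) x)"
  obtains M where "\<And>n x. x \<in> E \<Longrightarrow> nrm ((T ^^ n) x) \<le> M * cmod l ^ n * nrm x"
proof -
  obtain K where K: "K > 0" "\<And>x. x \<in> E \<Longrightarrow> nrm (R x) \<le> K * nrm x"
    by (rule bounded_op_bound[OF R]) blast
  define c where "c = rotation_bound * K * rotation_bound"
  have fin: "nrm ((T ^^ n) f) \<le> c * cmod l * cmod l ^ n * nrm f" if f: "f \<in> finite_seqs" for n f
  proof -
    have mem: "(T ^^ n) f \<in> E"
      using linear_op_mem[OF bounded_op_on_linear[OF bounded_op_funpow[OF T]] finite_mem[OF f]] .
    have "cmod (- ((1 / l) ^ Suc n)) * nrm ((T ^^ n) f) \<le> c * nrm f"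
      using nrm_diagonal_le[OF bounded_op_on_linear[OF R] K(2) less_imp_le[OF K(1)] f, of "d n"]
      unfolding diag[OF f] nrm_scale[OF mem] c_def .
    then have "cmod l ^ Suc n * ((1 / cmod l) ^ Suc n * nrm ((T ^^ n) f)) \<le> cmod l ^ Suc n * (c * nrm f)"
      by (intro mult_left_mono) (simp_all add: norm_power norm_divide norm_mult)
    moreover have "cmod l ^ Suc n * ((1 / cmod l) ^ Suc n * nrm ((T ^^ n) f)) = nrm ((T ^^ n) f)"
      using l by (simp add: power_divide)
    ultimately show ?thesis by (simp add: mult_ac)
  qed
  show thesis
    by (rule that, rule bound_extends_from_finite[OF bounded_op_funpow[OF T]]) (use fin in auto)
qed

text \<open>Rotations conjugate T to its unimodular multiples, so its spectrum is a union of circles.\<close>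

lemma not_in_spectrum_rotate:
  assumes T: "bounded_op_on E nrm T"
    and covariant: "\<And>z. cmod z = 1 \<Longrightarrow> \<exists>w. cmod w = 1 \<and>
      (\<forall>x. T (rotation w x) = seq_scale z (rotation w (T x)))"
    and l: "l \<notin> spectrum_on E nrm T" and m: "cmod m = cmod l"
  shows "m \<notin> spectrum_on E nrm T"
proof (cases "l = 0")
  case True
  then show ?thesis using l m by simp
next
  case False
  define z where "z = m / l"
  have z: "cmod z = 1" "z \<noteq> 0" "m = z * l" using False m by (auto simp: z_def norm_divide)
  obtain w where w: "cmod w = 1" "\<And>x. T (rotation w x) = seq_scale z (rotation w (T x))"
    using covariant[OF z(1)] by blast
  have w0: "w \<noteq> 0" and w': "cmod (inverse w) = 1" using w(1) by (auto simp: norm_inverse)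
  obtain R where R: "bounded_op_on E nrm R"
      and RT: "\<And>x. x \<in> E \<Longrightarrow> R (T x - seq_scale l x) = x"
      and TR: "\<And>x. x \<in> E \<Longrightarrow> T (R x) - seq_scale l (R x) = x"
    using l unfolding not_in_spectrum_iff by blast
  define R' where "R' x = rotation w (R (rotation (inverse w) (seq_scale (inverse z) x)))" for x
  have rot_inv: "rotation w (rotation (inverse w) x) = x" "rotation (inverse w) (rotation w x) = x" for x
    using w0 by (simp_all add: rotation_def fun_eq_iff power_inverse)
  have conj: "T (rotation w x) - seq_scale m (rotation w x) = seq_scale z (rotation w (T x - seq_scale l x))" for x
    unfolding w(2) z(3) by (simp add: rotation_def fun_eq_iff algebra_simps)
  have "bounded_op_on E nrm R'"
    unfolding R'_def
    by (intro bounded_op_compose[OF bounded_op_rotation[OF w(1)]] bounded_op_compose[OF R]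
        bounded_op_compose[OF bounded_op_rotation[OF w']] bounded_op_scale)
  moreover have "R' (T x - seq_scale m x) = x" if x: "x \<in> E" for x
  proof -
    define y where "y = rotation (inverse w) x"
    have y: "y \<in> E" "x = rotation w y" using x w' rot_inv by (simp_all add: y_def rotation_mem)
    have "rotation (inverse w) (seq_scale (inverse z) (T x - seq_scale m x)) = T y - seq_scale l y"
      unfolding y(2) conj using z(2) by (simp add: rot_inv)
    then show ?thesis unfolding R'_def using RT[OF y(1)] y(2) by simp
  qed
  moreover have "T (R' x) - seq_scale m (R' x) = x" if x: "x \<in> E" for x
  proof -
    have "rotation (inverse w) (seq_scale (inverse z) x) \<in> E" using x by (intro rotation_mem w' scale_mem)
    from TR[OF this] show ?thesis unfolding R'_def conj using z(2) by (simp only: rot_inv) simp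
  qed
  ultimately show ?thesis unfolding not_in_spectrum_iff by blast
qed

text \<open>If some l with modulus at most the spectral radius were outside the spectrum, the bound on the powers
  would exclude every point of modulus larger than that of l, and openness of the resolvent set together
  with rotation would exclude an annulus around the circle through l. The spectral radius
  would then be smaller than the modulus of l.\<close>

lemma spectrum_eq_disc:
  assumes T: "bounded_op_on E nrm T" and zero: "0 \<in> spectrum_on E nrm T"
    and covariant: "\<And>z. cmod z = 1 \<Longrightarrow> \<exists>w. cmod w = 1 \<and>
      (\<forall>x. T (rotation w x) = seq_scale z (rotation w (T x)))"
    and diag: "\<And>l R n x. \<lbrakk>l \<noteq> 0; \<And>x. x \<in> E \<Longrightarrow> R (T x - seq_scale l x) = x;
        \<And>x. x \<in> E \<Longrightarrow> T (R x) - seq_scale l (R x) = x; x \<in> finite_seqs\<rbrakk> \<Longrightarrow>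
      diagonal (d n) R x = seq_scale (- ((1 / l) ^ Suc n)) ((T ^^ n) x)"
  shows "spectrum_on E nrm T = {z. cmod z \<le> spectral_radius_on E nrm T}"
proof (intro subset_antisym subsetI)
  fix m assume "m \<in> spectrum_on E nrm T"
  then show "m \<in> {z. cmod z \<le> spectral_radius_on E nrm T}"
    unfolding spectral_radius_on_def using cSUP_upper[OF _ spectrum_bounded[OF T]] by blast
next
  fix l assume "l \<in> {z. cmod z \<le> spectral_radius_on E nrm T}"
  then have l_le: "cmod l \<le> spectral_radius_on E nrm T" by simp
  show "l \<in> spectrum_on E nrm T"
  proof (rule ccontr)
    assume l: "l \<notin> spectrum_on E nrm T"
    then have l0: "l \<noteq> 0" using zero by metis
    obtain R where R: "bounded_op_on E nrm R" "\<And>x. x \<in> E \<Longrightarrow> R (T x - seq_scale l x) = x"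
        "\<And>x. x \<in> E \<Longrightarrow> T (R x) - seq_scale l (R x) = x"
      using l unfolding not_in_spectrum_iff by blast
    obtain M where M: "\<And>n x. x \<in> E \<Longrightarrow> nrm ((T ^^ n) x) \<le> M * cmod l ^ n * nrm x"
      by (rule power_bound_of_resolvent[OF T R(1) l0, where d = d]) (use diag[OF l0 R(2,3)] in blast)+
    obtain e where e: "e > 0" "\<And>m. cmod (m - l) < e \<Longrightarrow> m \<notin> spectrum_on E nrm T"
      using resolvent_open[OF bounded_op_on_linear[OF T] l] by blast
    have "cmod m \<le> cmod l - e" if m: "m \<in> spectrum_on E nrm T" for m
    proof (rule ccontr)
      assume less: "\<not> cmod m \<le> cmod l - e"
      have le: "cmod m \<le> cmod l"
        using not_in_spectrum_if_power_bound[OF T M norm_ge_zero, of m] m by (meson not_le)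
      \<comment> \<open>m' lies on the circle of m and on the ray of l, hence at distance |l| - |m| < e from l.\<close>
      define m' where "m' = complex_of_real (cmod m / cmod l) * l"
      have "cmod m' = cmod m" using l0 by (simp add: m'_def norm_mult norm_divide)
      have "m' - l = complex_of_real (cmod m / cmod l - 1) * l" by (simp add: m'_def algebra_simps)
      then have "cmod (m' - l) = \<bar>cmod m / cmod l - 1\<bar> * cmod l" by (simp only: norm_mult norm_of_real)
      also have "\<dots> = cmod l - cmod m" using le l0 by (simp add: abs_if field_simps)
      finally have "m' \<notin> spectrum_on E nrm T" using less by (intro e(2)) linarith
      then show False
        using not_in_spectrum_rotate[OF T covariant] m \<open>cmod m' = cmod m\<close> by metis
    qed
    then have "spectral_radius_on E nrm T \<le> cmod l - e"
      unfolding spectral_radius_on_def using zero by (intro cSUP_least) auto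
    then show False using l_le e(1) by linarith
  qed
qed

section \<open>The two shifts\<close>

lemma right_shift_apply: "right_shift u n = (if n = 0 then 0 else u (n - 1))"
  by (simp add: right_shift_def)

lemma left_shift_apply: "left_shift u n = u (n + 1)"
  by (simp add: left_shift_def)

lemma right_shift_power: "(right_shift ^^ n) u k = (if n \<le> k then u (k - n) else 0)"
  by (induction n arbitrary: k) (auto simp: right_shift_apply)

lemma left_shift_power: "(left_shift ^^ n) u k = u (k + n)"
  by (induction n arbitrary: k) (auto simp: left_shift_apply)

lemma right_shift_bounded:
  assumes "right_shift ` E \<subseteq> E" shows "bounded_op_on E nrm right_shift"
proof (rule coordinatewise_bounded_imp_bounded)
  show "linear_op_on E right_shift"
    using assms by (auto simp: linear_op_on_def right_shift_def fun_eq_iff)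
  show "\<exists>C. \<forall>x\<in>E. cmod (right_shift x n) \<le> C * nrm x" for n
    using coordinate_bounded[of "n - 1"] by (cases n) (auto simp: right_shift_apply intro: exI[of _ 0])
qed (rule coordinate_bounded)

lemma left_shift_bounded:
  assumes "left_shift ` E \<subseteq> E" shows "bounded_op_on E nrm left_shift"
proof (rule coordinatewise_bounded_imp_bounded)
  show "linear_op_on E left_shift"
    using assms by (auto simp: linear_op_on_def left_shift_def fun_eq_iff)
  show "\<exists>C. \<forall>x\<in>E. cmod (left_shift x n) \<le> C * nrm x" for n
    using coordinate_bounded[of "n + 1"] by (simp add: left_shift_apply)
qed (rule coordinate_bounded)

text \<open>The resolvent equation is a first-order recursion whose initial value is forced, because the right
  shift has 0 as its value at index 0. So any solution, and not only one with finite support, has these entries.\<close>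

lemma right_shift_resolvent_entry:
  assumes l: "l \<noteq> 0" and u: "right_shift u - seq_scale l u = unit_seq j"
  shows "u (j + n) = - ((1 / l) ^ Suc n)"
proof -
  have eq: "right_shift u k - l * u k = unit_seq j k" for k
    using fun_cong[OF u, of k] by simp
  have low: "u k = 0" if "k < j" for k
    using that
  proof (induction k)
    case 0
    then show ?case using eq[of 0] l by (simp add: right_shift_apply unit_seq_apply)
  next
    case (Suc k)
    then show ?case using eq[of "Suc k"] l by (simp add: right_shift_apply unit_seq_apply)
  qed
  show ?thesis
  proof (induction n)
    case 0
    have "right_shift u j = 0" using low[of "j - 1"] by (simp add: right_shift_apply)
    then show ?case using eq[of j] l by (simp add: unit_seq_apply field_simps) (metis add.inverse_inverse)
  next
    case (Suc n)
    then show ?case using eq[of "j + Suc n"] l by (simp add: right_shift_apply unit_seq_apply field_simps)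
  qed
qed

text \<open>0 is in the spectrum because the first unit sequence is not in the range.\<close>

lemma right_shift_spectrum:
  assumes "right_shift ` E \<subseteq> E"
  shows "spectrum_on E nrm right_shift = {z. cmod z \<le> spectral_radius_on E nrm right_shift}"
proof (rule spectrum_eq_disc[where d = int])
  show "bounded_op_on E nrm right_shift" by (rule right_shift_bounded) fact
  show "0 \<in> spectrum_on E nrm right_shift"
  proof (rule ccontr)
    assume "0 \<notin> spectrum_on E nrm right_shift"
    then obtain R where "right_shift (R (unit_seq 0)) - seq_scale 0 (R (unit_seq 0)) = unit_seq 0"
      unfolding not_in_spectrum_iff using unit_seq_mem by blast
    from fun_cong[OF this, of 0] show False by (simp add: right_shift_apply unit_seq_apply)
  qed
  show "\<exists>w. cmod w = 1 \<and> (\<forall>x. right_shift (rotation w x) = seq_scale z (rotation w (right_shift x)))"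
    if z: "cmod z = 1" for z
  proof (intro exI conjI allI ext)
    have "z \<noteq> 0" using z by auto
    then show "right_shift (rotation (inverse z) x) n = seq_scale z (rotation (inverse z) (right_shift x)) n" for x n
      by (cases n) (auto simp: right_shift_apply rotation_def)
  qed (simp add: z norm_inverse)
next
  fix l R n x
  assume l: "l \<noteq> 0" and R: "\<And>x. x \<in> E \<Longrightarrow> right_shift (R x) - seq_scale l (R x) = x"
  show "diagonal (int n) R x = seq_scale (- ((1 / l) ^ Suc n)) ((right_shift ^^ n) x)"
  proof
    fix k
    show "diagonal (int n) R x k = seq_scale (- ((1 / l) ^ Suc n)) ((right_shift ^^ n) x) k"
    proof (cases "n \<le> k")
      case True
      have "R (unit_seq (k - n)) ((k - n) + n) = - ((1 / l) ^ Suc n)"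
        by (rule right_shift_resolvent_entry[OF l R[OF unit_seq_mem]])
      moreover have "nat (int k - int n) = k - n" by simp
      ultimately show ?thesis
        using True unfolding diagonal_def seq_scale_apply right_shift_power by simp
    qed (simp add: diagonal_def right_shift_power)
  qed
qed

text \<open>0 is in the spectrum because the first unit sequence is in the kernel. The left shift is nilpotent on
  each unit sequence, so the resolvent equation has a finitely supported solution there, and applying
  R to that equation shows that R produces this solution.\<close>

lemma left_shift_spectrum:
  assumes "left_shift ` E \<subseteq> E"
  shows "spectrum_on E nrm left_shift = {z. cmod z \<le> spectral_radius_on E nrm left_shift}"
proof (rule spectrum_eq_disc[where d = "\<lambda>n. - int n"])
  show T: "bounded_op_on E nrm left_shift" by (rule left_shift_bounded) fact
  show "0 \<in> spectrum_on E nrm left_shift"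
  proof (rule ccontr)
    assume "0 \<notin> spectrum_on E nrm left_shift"
    then obtain R where R: "bounded_op_on E nrm R"
        "R (left_shift (unit_seq 0) - seq_scale 0 (unit_seq 0)) = unit_seq 0"
      unfolding not_in_spectrum_iff using unit_seq_mem by blast
    have "left_shift (unit_seq 0) - seq_scale 0 (unit_seq 0) = 0"
      by (simp add: left_shift_def unit_seq_def fun_eq_iff)
    with R have "unit_seq 0 = 0" using linear_op_zero[OF bounded_op_on_linear[OF R(1)]] by simp
    from fun_cong[OF this, of 0] show False by (simp add: unit_seq_apply)
  qed
  show "\<exists>w. cmod w = 1 \<and> (\<forall>x. left_shift (rotation w x) = seq_scale z (rotation w (left_shift x)))"
    if z: "cmod z = 1" for z
    using z by (intro exI[of _ z]) (auto simp: left_shift_def rotation_def fun_eq_iff)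
next
  fix l R n x
  assume l: "l \<noteq> 0" and R: "\<And>x. x \<in> E \<Longrightarrow> R (left_shift x - seq_scale l x) = x"
  have R_unit: "R (unit_seq j) = (\<lambda>k. if k \<le> j then - ((1 / l) ^ Suc (j - k)) else 0)" (is "_ = ?v") for j
  proof -
    have "?v \<in> E" by (intro finite_mem finite_seqsI[of "Suc j"]) auto
    moreover have "left_shift ?v - seq_scale l ?v = unit_seq j"
    proof
      fix k
      show "(left_shift ?v - seq_scale l ?v) k = unit_seq j k"
      proof (cases k j rule: linorder_cases)
        case less
        then have "j - k = Suc (j - Suc k)" by simp
        then show ?thesis using less l by (simp add: left_shift_apply unit_seq_apply)
      qed (use l in \<open>simp_all add: left_shift_apply unit_seq_apply\<close>)
    qed
    ultimately show ?thesis using R[of ?v] by simp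
  qed
  show "diagonal (- int n) R x = seq_scale (- ((1 / l) ^ Suc n)) ((left_shift ^^ n) x)"
  proof
    fix k
    have "nat (int k - - int n) = k + n" by simp
    then show "diagonal (- int n) R x k = seq_scale (- ((1 / l) ^ Suc n)) ((left_shift ^^ n) x) k"
      unfolding diagonal_def seq_scale_apply left_shift_power R_unit by simp
  qed
qed

end

theorem theorem4:
  fixes E :: "(nat \<Rightarrow> complex) set" and nrm :: "(nat \<Rightarrow> complex) \<Rightarrow> real"
  assumes "rotation_banach_seq_space E nrm"
    and "right_shift ` E \<subseteq> E"
    and "left_shift ` E \<subseteq> E"
  shows "spectrum_on E nrm right_shift = {z. cmod z \<le> spectral_radius_on E nrm right_shift} \<and>
         spectrum_on E nrm left_shift = {z. cmod z \<le> spectral_radius_on E nrm left_shift}"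
proof -
  interpret rotation_banach_seq_space E nrm by fact
  show ?thesis
    using right_shift_spectrum[OF assms(2)] left_shift_spectrum[OF assms(3)] by simp
qed

end
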